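(* Let $r>s>0$ be integers and $\underline{x}=(x_2,\ldots,x_r)$ a tuple of elements of $\{0,1\}$. Any $\Phi$-irreducible element $w$ of $\Gamma_{\underline{x}}$ is $W$-conjugate to a $\Phi$-irreducible element of $\Gamma_{(0,\ldots,0)}$ (for the same pair $(r,s)$).
   Context: Let $T$ be the infinite rooted regular binary tree whose vertices are the finite words over $\{0,1\}$, with root the empty word, each word $t$ being joined by an edge to the words $0t$ and $1t$. Let $W=\mathrm{Aut}(T)$ be the automorphism group of $T$ (products are compositions, $(uv)(t)=u(v(t))$), with identity element $1$. For $u,v\in W$, let $(u,v)\in W$ be the automorphism fixing the root and given by $t0\mapsto u(t)0$ and $t1\mapsto v(t)1$ for every word $t$. Let $\sigma\in W$ be the involution fixing the root with $t0\mapsto t1$ and $t1\mapsto t0$ for every word $t$. Then $W=(W\times W)\rtimes\langle\sigma\rangle$, so every $w\in W$ can be written uniquely as $(u,v)$ or as $(u,v)\,\sigma$. The first descendants of $w\in W$ are the elements $u$ and $v$ if $w=(u,v)$, respectively the single element $uv$ if $w=(u,v)\,\sigma$. For $n\ge1$, the first descendants of the $n$-th descendants of $w$ are the $(n+1)$-st descendants of $w$. $\mathrm{Desc}(w)$ is the set of all $n$-th descendants of $w$ for all $n\ge1$. An element $w$ is called $\Phi$-irreducible if $\mathrm{Desc}(w)$ is finite and $w\in\mathrm{Desc}(w)$. For any tuple $\underline{x}=(x_2,\ldots,x_r)$ of elements of $\{0,1\}$, let $b_1,\ldots,b_r\in W$ be the elements determined by the recursion relations $b_1=\sigma$; $b_{s+1}=(b_r,b_s)$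 if $x_{s+1}=0$; $b_{s+1}=(b_s,b_r)$ if $x_{s+1}=1$; $b_i=(b_{i-1},1)$ for all $i\ne1,s+1$ with $x_i=0$; $b_i=(1,b_{i-1})$ for all $i\neq1,s+1$ with $x_i=1$. Let $\Gamma_{\underline{x}}\subset W$ be the subgroup generated by $b_1,\ldots,b_r$. *)

theory Defs
  imports "HOL-Library.Z2" "HOL-Library.FuncSet" "HOL-Algebra.Generated_Groups"
begin

section \<open>The rooted binary tree and its automorphism group\<close>

text \<open>The letters are the two elements of type \<^typ>\<open>bit\<close>. The children of a word \<open>t\<close> are obtained by
  prefixing a letter, so the subtree of words ending in \<open>l\<close> hangs below the level-one vertex \<open>[l]\<close>.
  Automorphisms are those of the rooted tree; fixing the root is in fact automatic, as the root is
  the only vertex of degree two.\<close>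

type_synonym word = "bit list"

definition tree_adj :: "word \<Rightarrow> word \<Rightarrow> bool" where
  "tree_adj t t' \<longleftrightarrow> (\<exists>l. t' = l # t \<or> t = l # t')"

definition tree_auts :: "(word \<Rightarrow> word) set" where
  "tree_auts = {f. bij f \<and> f [] = [] \<and> (\<forall>t t'. tree_adj (f t) (f t') \<longleftrightarrow> tree_adj t t')}"

definition AutT :: "(word \<Rightarrow> word) monoid" where
  "AutT = \<lparr>carrier = tree_auts, monoid.mult = (\<circ>), one = id\<rparr>"

definition wpair :: "(word \<Rightarrow> word) \<Rightarrow> (word \<Rightarrow> word) \<Rightarrow> word \<Rightarrow> word" where
  "wpair u v t = (if t = [] then []
     else if last t = 0 then u (butlast t) @ [0] else v (butlast t) @ [1])"

definition \<sigma> :: "word \<Rightarrow> word" where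
  "\<sigma> t = (if t = [] then [] else butlast t @ [if last t = 0 then 1 else 0])"

section \<open>Descendants\<close>

definition first_desc :: "(word \<Rightarrow> word) \<Rightarrow> (word \<Rightarrow> word) set" where
  "first_desc w = {y. \<exists>u\<in>carrier AutT. \<exists>v\<in>carrier AutT.
     (w = wpair u v \<and> (y = u \<or> y = v)) \<or> (w = wpair u v \<otimes>\<^bsub>AutT\<^esub> \<sigma> \<and> y = u \<otimes>\<^bsub>AutT\<^esub> v)}"

primrec nth_desc :: "nat \<Rightarrow> (word \<Rightarrow> word) \<Rightarrow> (word \<Rightarrow> word) set" where
  "nth_desc 0 w = {w}"
| "nth_desc (Suc n) w = (\<Union>y\<in>nth_desc n w. first_desc y)"

definition Desc :: "(word \<Rightarrow> word) \<Rightarrow> (word \<Rightarrow> word) set" where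
  "Desc w = (\<Union>n\<in>{1..}. nth_desc n w)"

definition \<Phi>_irreducible :: "(word \<Rightarrow> word) \<Rightarrow> bool" where
  "\<Phi>_irreducible w \<longleftrightarrow> finite (Desc w) \<and> w \<in> Desc w"

section \<open>The groups generated by the recursively defined elements\<close>

text \<open>A tuple \<open>(x\<^sub>2, \<dots>, x\<^sub>r)\<close> is represented by any function taking the value \<open>x\<^sub>i\<close> at each \<open>i\<close> in
  \<open>{2..r}\<close>; its other values are never used.\<close>

definition recursion_relations :: "nat \<Rightarrow> nat \<Rightarrow> (nat \<Rightarrow> bit) \<Rightarrow> (nat \<Rightarrow> word \<Rightarrow> word) \<Rightarrow> bool" where
  "recursion_relations r s x b \<longleftrightarrow>
     b \<in> {1..r} \<rightarrow>\<^sub>E carrier AutT \<and>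
     b 1 = \<sigma> \<and>
     b (s + 1) = (if x (s + 1) = 0 then wpair (b r) (b s) else wpair (b s) (b r)) \<and>
     (\<forall>i\<in>{1..r} - {1, s + 1}.
        b i = (if x i = 0 then wpair (b (i - 1)) \<one>\<^bsub>AutT\<^esub> else wpair \<one>\<^bsub>AutT\<^esub> (b (i - 1))))"

text \<open>Existence and uniqueness of the solution for \<open>0 < s < r\<close> are proved at the end, in
  \<open>gens_recursion_relations\<close> and \<open>recursion_relations_unique\<close>.\<close>

definition gens :: "nat \<Rightarrow> nat \<Rightarrow> (nat \<Rightarrow> bit) \<Rightarrow> nat \<Rightarrow> word \<Rightarrow> word" where
  "gens r s x = (THE b. recursion_relations r s x b)"

definition \<Gamma> :: "nat \<Rightarrow> nat \<Rightarrow> (nat \<Rightarrow> bit) \<Rightarrow> (word \<Rightarrow> word) set" where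
  "\<Gamma> r s x = generate AutT (gens r s x ` {1..r})"

section \<open>Well-definedness\<close>

lemma carrier_AutT [simp]: "carrier AutT = tree_auts"
  and mult_AutT [simp]: "f \<otimes>\<^bsub>AutT\<^esub> g = f \<circ> g"
  and one_AutT [simp]: "\<one>\<^bsub>AutT\<^esub> = id"
  by (simp_all add: AutT_def)

lemma group_AutT: "group AutT"
proof (rule groupI)
  fix f assume "f \<in> carrier AutT"
  then have f: "bij f" "f [] = []" "\<And>t t'. tree_adj (f t) (f t') \<longleftrightarrow> tree_adj t t'"
    by (auto simp: tree_auts_def)
  let ?g = "inv_into UNIV f"
  have "tree_adj (?g t) (?g t') \<longleftrightarrow> tree_adj t t'" for t t'
    using f(3)[of "?g t" "?g t'"] f(1) by (simp add: bij_is_surj surj_f_inv_f)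
  moreover have "?g [] = []"
    using f(1,2) by (metis bij_inv_eq_iff)
  ultimately have "?g \<in> tree_auts"
    using f(1) by (simp add: tree_auts_def bij_imp_bij_inv)
  moreover have "?g \<circ> f = id"
    using f(1) by (simp add: bij_is_inj)
  ultimately show "\<exists>g\<in>carrier AutT. g \<otimes>\<^bsub>AutT\<^esub> f = \<one>\<^bsub>AutT\<^esub>"
    by auto
qed (auto simp: tree_auts_def bij_comp)

lemma tree_auts_length_tl:
  assumes "f \<in> tree_auts"
  shows "length (f t) = length t \<and> tl (f t) = f (tl t)"
proof (induction t)
  case Nil
  then show ?case using assms by (simp add: tree_auts_def)
next
  case (Cons l t)
  have f: "inj f" "f [] = []" "tree_adj (f t) (f (l # t))"
    using assms by (auto simp: tree_auts_def bij_is_inj tree_adj_def)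
  then consider k where "f (l # t) = k # f t" | k where "f t = k # f (l # t)"
    by (auto simp: tree_adj_def)
  then show ?case
  proof cases
    case 1
    then show ?thesis using Cons by simp
  next
    case 2
    then have "f (tl t) = f (l # t)"
      using Cons by simp
    then have "tl t = l # t"
      using f(1) by (simp add: inj_eq)
    then have "length (tl t) = Suc (length t)" by simp
    then show ?thesis by simp
  qed
qed

lemma bit_cases: "(l :: bit) = 0 \<or> l = 1"
  by (cases l) auto

lemma finite_UNIV_bit: "finite (UNIV :: bit set)"
  by (rule finite_subset[of _ "{0, 1}"]) (use bit_cases in auto)

lemma tree_autsI:
  assumes len: "\<And>t. length (f t) = length t"
    and tl: "\<And>t. tl (f t) = f (tl t)"
    and inj: "inj f"
  shows "f \<in> tree_auts"
proof -
  have "surj f"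
  proof -
    have "t \<in> range f" for t
    proof -
      let ?A = "{u :: word. set u \<subseteq> UNIV \<and> length u = length t}"
      have "finite ?A"
        by (rule finite_lists_length_eq) (rule finite_UNIV_bit)
      moreover have "f ` ?A \<subseteq> ?A" using len by auto
      moreover have "inj_on f ?A" using inj by (rule inj_on_subset) simp
      ultimately have "f ` ?A = ?A" by (rule endo_inj_surj)
      then show ?thesis by blast
    qed
    then show ?thesis by blast
  qed
  moreover have nil: "f [] = []"
    using len[of "[]"] by simp
  moreover have "tree_adj (f t) (f t') \<longleftrightarrow> tree_adj t t'" for t t'
  proof -
    have adj: "(\<exists>l. u = l # v) \<longleftrightarrow> u \<noteq> [] \<and> tl u = v" for u v :: word
      by (cases u) auto
    have "(\<exists>l. f u = l # f v) \<longleftrightarrow> (\<exists>l. u = l # v)" for u v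
    proof -
      have "f u = [] \<longleftrightarrow> u = []"
        using len[of u] by (metis length_0_conv)
      moreover have "tl (f u) = f v \<longleftrightarrow> tl u = v"
        unfolding tl using inj by (rule inj_eq)
      ultimately show ?thesis
        unfolding adj by blast
    qed
    then show ?thesis
      unfolding tree_adj_def by blast
  qed
  ultimately show ?thesis
    using inj by (simp add: tree_auts_def bij_def)
qed

lemma wpair_simps [simp]:
  "wpair u v [] = []"
  "wpair u v (t @ [0]) = u t @ [0]"
  "wpair u v (t @ [1]) = v t @ [1]"
  by (simp_all add: wpair_def)

lemma sigma_simps [simp]:
  "\<sigma> [] = []"
  "\<sigma> (t @ [0]) = t @ [1]"
  "\<sigma> (t @ [1]) = t @ [0]"
  by (simp_all add: \<sigma>_def)

function gens_fun :: "nat \<Rightarrow> nat \<Rightarrow> (nat \<Rightarrow> bit) \<Rightarrow> nat \<Rightarrow> word \<Rightarrow> word" where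
  "gens_fun r s x i t =
    (if t = [] then []
     else if i = 1 then \<sigma> t
     else if i = s + 1 then
       (if last t = x (s + 1) then gens_fun r s x r (butlast t) else gens_fun r s x s (butlast t)) @ [last t]
     else (if last t = x i then gens_fun r s x (i - 1) (butlast t) else butlast t) @ [last t])"
  by pat_completeness auto
termination
  by (relation "Wellfounded.measure (\<lambda>(r, s, x, i, t). length t)") auto

declare gens_fun.simps [simp del]

lemma gens_fun_Nil [simp]: "gens_fun r s x i [] = []"
  by (simp add: gens_fun.simps)

lemma gens_fun_snoc:
  "gens_fun r s x i (t @ [l]) =
    (if i = 1 then \<sigma> (t @ [l])
     else if i = s + 1 then
       (if l = x (s + 1) then gens_fun r s x r t else gens_fun r s x s t) @ [l]
     else (if l = x i then gens_fun r s x (i - 1) t else t) @ [l])"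
  by (subst gens_fun.simps) simp

lemma sigma_snoc: "\<sigma> (t @ [l]) = t @ [if l = 0 then 1 else 0]"
  by (simp add: \<sigma>_def)

lemma gens_fun_length: "length (gens_fun r s x i t) = length t"
  by (induction t arbitrary: i rule: rev_induct) (auto simp: gens_fun_snoc sigma_snoc)

lemma gens_fun_Nil_iff: "gens_fun r s x i t = [] \<longleftrightarrow> t = []"
  using gens_fun_length[of r s x i t] by auto

lemma tl_snoc: "tl (t @ [l]) = (if t = [] then [] else tl t @ [l])"
  by (cases t) auto

lemma gens_fun_tl: "tl (gens_fun r s x i t) = gens_fun r s x i (tl t)"
proof (induction t arbitrary: i rule: rev_induct)
  case Nil
  then show ?case by simp
next
  case (snoc l t)
  have "tl (gens_fun r s x i [l]) = []"
    using gens_fun_length[of r s x i "[l]"] by (cases "gens_fun r s x i [l]") auto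
  with snoc show ?case
    by (cases "t = []") (auto simp: gens_fun_snoc sigma_snoc tl_snoc gens_fun_Nil_iff)
qed

lemma gens_fun_inj: "gens_fun r s x i t = gens_fun r s x i t' \<Longrightarrow> t = t'"
proof (induction t arbitrary: i t' rule: rev_induct)
  case Nil
  then show ?case using gens_fun_Nil_iff[of r s x i t'] by simp
next
  case (snoc l t)
  from snoc.prems have "t' \<noteq> []"
    by (metis gens_fun_Nil_iff snoc_eq_iff_butlast)
  then obtain u k where t': "t' = u @ [k]"
    by (metis rev_exhaust)
  show ?case
  proof (cases "i = 1")
    case True
    then show ?thesis
      using snoc.prems bit_cases[of k] bit_cases[of l]
      unfolding t' by (auto simp: gens_fun_snoc sigma_snoc)
  next
    case False
    have kl: "k = l"
      using snoc.prems False unfolding t' gens_fun_snoc by (simp split: if_splits)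
    have "t = u"
      using snoc.prems False unfolding t' kl gens_fun_snoc by (simp split: if_splits) (erule snoc.IH)+
    then show ?thesis
      unfolding t' kl by simp
  qed
qed

lemma gens_fun_in: "gens_fun r s x i \<in> tree_auts"
  by (intro tree_autsI gens_fun_length gens_fun_tl injI) (rule gens_fun_inj)

lemma recursion_relations_exists:
  assumes "0 < s" "s < r"
  shows "recursion_relations r s x (restrict (gens_fun r s x) {1..r})"
proof -
  have eqI: "f = g" if "f [] = g []" "\<And>t. f (t @ [0]) = g (t @ [0])" "\<And>t. f (t @ [1]) = g (t @ [1])"
    for f g :: "word \<Rightarrow> word"
  proof
    fix t show "f t = g t"
      using that bit_cases[of "last t"] by (cases t rule: rev_cases) auto
  qed
  have 1: "gens_fun r s x 1 = \<sigma>"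
    by (rule eqI) (simp_all add: gens_fun_snoc)
  have 2: "gens_fun r s x (s + 1) = (if x (s + 1) = 0
      then wpair (gens_fun r s x r) (gens_fun r s x s)
      else wpair (gens_fun r s x s) (gens_fun r s x r))"
    using assms bit_cases[of "x (s + 1)"] by (intro eqI) (auto simp: gens_fun_snoc)
  have 3: "gens_fun r s x i = (if x i = 0
      then wpair (gens_fun r s x (i - 1)) id else wpair id (gens_fun r s x (i - 1)))"
    if "i \<noteq> 1" "i \<noteq> s + 1" for i
    using that bit_cases[of "x i"] by (intro eqI) (auto simp: gens_fun_snoc)
  let ?b = "restrict (gens_fun r s x) {1..r}"
  have b: "?b i = gens_fun r s x i" if "i \<in> {1..r}" for i
    using that by simp
  have "?b i = (if x i = 0 then wpair (?b (i - 1)) \<one>\<^bsub>AutT\<^esub> else wpair \<one>\<^bsub>AutT\<^esub> (?b (i - 1)))"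
    if i: "i \<in> {1..r} - {1, s + 1}" for i
  proof -
    have "i \<in> {1..r}" "i - 1 \<in> {1..r}" "i \<noteq> 1" "i \<noteq> s + 1" using i by auto
    then show ?thesis by (simp only: b one_AutT, intro 3)
  qed
  moreover have "?b \<in> {1..r} \<rightarrow>\<^sub>E carrier AutT"
    using gens_fun_in by simp
  moreover have "?b 1 = \<sigma>"
    using b[of 1] 1 assms by simp
  moreover have "?b (s + 1) = (if x (s + 1) = 0 then wpair (?b r) (?b s) else wpair (?b s) (?b r))"
  proof -
    have "s + 1 \<in> {1..r}" "r \<in> {1..r}" "s \<in> {1..r}" using assms by auto
    then show ?thesis by (simp only: b 2)
  qed
  ultimately show ?thesis
    unfolding recursion_relations_def by blast
qed

lemma recursion_relations_unique:
  assumes "0 < s" "s < r" "recursion_relations r s x b" "recursion_relations r s x b'"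
  shows "b = b'"
proof -
  have root: "b i [] = []" "b' i [] = []" if "i \<in> {1..r}" for i
    using that assms(3,4) by (auto simp: recursion_relations_def tree_auts_def PiE_iff)
  have eq: "b i t = b' i t" if "i \<in> {1..r}" for i t
    using that
  proof (induction t arbitrary: i rule: rev_induct)
    case Nil
    then show ?case by (simp add: root)
  next
    case (snoc l t)
    consider "i = 1" | "i = s + 1" | "i \<in> {1..r} - {1, s + 1}" using snoc.prems by blast
    then show ?case
    proof cases
      case 1
      then show ?thesis using assms(3,4) by (simp add: recursion_relations_def)
    next
      case 2
      have "b s t = b' s t" "b r t = b' r t"
        using assms(1,2) by (auto intro: snoc.IH)
      then show ?thesis
        using assms(3,4) 2 by (simp add: recursion_relations_def wpair_def)
    next
      case 3
      then have "b (i - 1) t = b' (i - 1) t"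
        by (auto intro!: snoc.IH)
      then show ?thesis
        using assms(3,4) 3 by (simp add: recursion_relations_def wpair_def)
    qed
  qed
  show ?thesis
  proof
    fix i show "b i = b' i"
    proof (cases "i \<in> {1..r}")
      case True
      then show ?thesis using eq by blast
    next
      case False
      then show ?thesis
        using assms(3,4) by (simp add: recursion_relations_def PiE_iff extensional_def del: atLeastAtMost_iff)
    qed
  qed
qed

lemma gens_recursion_relations:
  assumes "0 < s" "s < r"
  shows "recursion_relations r s x (gens r s x)"
proof -
  have "\<exists>!b. recursion_relations r s x b"
    by (meson assms recursion_relations_exists recursion_relations_unique)
  then show ?thesis
    unfolding gens_def by (rule theI')
qed

end

theory Submission
  imports Defs
begin

text \<open>A first descendant of a word in the generators is again given by a word. Call the letters
  \<open>b\<^sub>i\<close> with \<open>i > s\<close> marks: passing to a descendant never increases their number, so along a cycle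
  through an irreducible \<open>w\<close>, lifted to words starting with the fewest marks, it is constant. Hence
  at a step where the current element fixes the first level, all marks pass to the chosen side and
  no new letter \<open>b\<^sub>s\<close> appears there. A letter \<open>b\<^sub>s\<close> born at a swapping step takes \<open>s\<close> steps to
  become \<open>\<sigma>\<close>, so step \<open>j + s\<close> swaps only if step \<open>j\<close> does; by periodicity this is an equivalence.
  It follows that at a non-swapping step the word contains no \<open>\<sigma>\<close> and that every letter is active
  on the same side, the other side being a power of \<open>b\<^sub>s\<close>. So the \<open>W\<close>-conjugacy class of \<open>w\<close> depends
  only on the parities of the letter counts, and these follow a rule that does not involve \<open>x\<close>. A
  word for \<open>x = 0\<close> with the same parities is then conjugate to \<open>w\<close>, and the pigeonhole principle
  on its descendants yields an irreducible one.\<close>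

section \<open>Tree automorphisms and uniqueness of the wreath decomposition\<close>

lemma tree_auts_length: "f \<in> tree_auts \<Longrightarrow> length (f t) = length t"
  and tree_auts_tl: "f \<in> tree_auts \<Longrightarrow> tl (f t) = f (tl t)"
  using tree_auts_length_tl by auto

lemma tree_auts_Nil: "f \<in> tree_auts \<Longrightarrow> f [] = []"
  and tree_auts_inj: "f \<in> tree_auts \<Longrightarrow> inj f"
  by (auto simp: tree_auts_def bij_is_inj)

lemma id_tree_auts: "id \<in> tree_auts"
  using group.is_monoid[OF group_AutT, THEN monoid.one_closed] by simp

lemma comp_tree_auts: "f \<in> tree_auts \<Longrightarrow> g \<in> tree_auts \<Longrightarrow> f \<circ> g \<in> tree_auts"
  using group.is_monoid[OF group_AutT, THEN monoid.m_closed, of f g] by simp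

lemma tree_auts_inverse:
  assumes "f \<in> tree_auts"
  obtains g where "g \<in> tree_auts" "\<And>t. f (g t) = t" "\<And>t. g (f t) = t"
proof
  let ?g = "inv\<^bsub>AutT\<^esub> f"
  show "?g \<in> tree_auts"
    using assms group.inv_closed[OF group_AutT, of f] by simp
  have "f \<circ> ?g = id" "?g \<circ> f = id"
    using assms group.r_inv[OF group_AutT, of f] group.l_inv[OF group_AutT, of f] by auto
  then show "f (?g t) = t" "?g (f t) = t" for t
    by (metis comp_apply id_apply)+
qed

lemma bit_neq_iff: "(l :: bit) \<noteq> m \<longleftrightarrow> l = m + 1"
  by (cases l; cases m) auto

lemma bit_neq_succ: "(l :: bit) \<noteq> l + 1"
  by (cases l) auto

lemma word_eqI:
  assumes "f [] = g []" "\<And>t l. f (t @ [l]) = g (t @ [l])"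
  shows "f = (g :: word \<Rightarrow> word)"
proof
  show "f t = g t" for t
    using assms by (cases t rule: rev_cases) auto
qed

lemma wpair_snoc: "wpair u v (t @ [l]) = (if l = 0 then u t else v t) @ [l]"
  using bit_cases[of l] by auto

lemma wpair_eq_iff: "wpair u v = wpair u' v' \<longleftrightarrow> u = u' \<and> v = v'"
proof
  assume eq: "wpair u v = wpair u' v'"
  have "u t = u' t" "v t = v' t" for t
    using fun_cong[OF eq, of "t @ [0]"] fun_cong[OF eq, of "t @ [1]"] by simp_all
  then show "u = u' \<and> v = v'" by auto
qed simp

lemma sigma_sigma: "\<sigma> \<circ> \<sigma> = id"
  by (rule word_eqI) (use bit_cases in \<open>auto simp: sigma_snoc\<close>)

lemma wpair_sigma_eq_iff: "wpair u v \<circ> \<sigma> = wpair u' v' \<circ> \<sigma> \<longleftrightarrow> u = u' \<and> v = v'"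
proof -
  have "wpair u v \<circ> \<sigma> = wpair u' v' \<circ> \<sigma> \<longleftrightarrow> wpair u v = wpair u' v'"
    by (metis comp_assoc comp_id sigma_sigma)
  then show ?thesis by (simp add: wpair_eq_iff)
qed

lemma wpair_neq_sigma: "wpair u v \<noteq> wpair u' v' \<circ> \<sigma>"
proof
  assume "wpair u v = wpair u' v' \<circ> \<sigma>"
  then have "wpair u v ([] @ [0]) = (wpair u' v' \<circ> \<sigma>) ([] @ [0])" by simp
  then show False unfolding comp_apply sigma_simps wpair_simps by simp
qed

section \<open>Conjugacy by coinduction\<close>

text \<open>The recursion runs on a level counter because \<open>\<beta>\<close> alters the word
  before the recursive call, so only its length drops. \<open>c\<close> chooses the next index, and
  \<open>e\<close> decides whether the children are exchanged.\<close>

primrec level_map ::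
  "('i \<Rightarrow> bit) \<Rightarrow> ('i \<Rightarrow> bit \<Rightarrow> 'i) \<Rightarrow> ('i \<Rightarrow> bit \<Rightarrow> word \<Rightarrow> word) \<Rightarrow> ('i \<Rightarrow> bit \<Rightarrow> word \<Rightarrow> word) \<Rightarrow>
    nat \<Rightarrow> 'i \<Rightarrow> word \<Rightarrow> word" where
  "level_map e c \<alpha> \<beta> 0 p t = []"
| "level_map e c \<alpha> \<beta> (Suc n) p t =
    \<alpha> p (last t) (level_map e c \<alpha> \<beta> n (c p (last t)) (\<beta> p (last t) (butlast t))) @ [last t + e p]"

text \<open>Since \<open>\<beta>\<close> preserves lengths, the counter can be
  \<open>length t\<close>; the criterion \<open>tree_autsI\<close> is then checked by induction on
  the length.\<close>

lemma tree_auts_recursion: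
  fixes e :: "'i \<Rightarrow> bit" and c :: "'i \<Rightarrow> bit \<Rightarrow> 'i"
  assumes \<alpha>: "\<And>p l. \<alpha> p l \<in> tree_auts" and \<beta>: "\<And>p l. \<beta> p l \<in> tree_auts"
  obtains G where "\<And>p. G p \<in> tree_auts"
    "\<And>p t l. G p (t @ [l]) = \<alpha> p l (G (c p l) (\<beta> p l t)) @ [l + e p]"
proof -
  define G where "G p t = level_map e c \<alpha> \<beta> (length t) p t" for p t
  have G_Nil: "G p [] = []" for p
    by (simp add: G_def)
  have G_snoc: "G p (t @ [l]) = \<alpha> p l (G (c p l) (\<beta> p l t)) @ [l + e p]" for p t l
    using \<beta> by (simp add: G_def tree_auts_length)
  have len: "length (G p t) = length t" for p t
  proof (induction "length t" arbitrary: p t)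
    case 0
    then show ?case by (simp add: G_Nil)
  next
    case (Suc n)
    then obtain u l where "t = u @ [l]" by (metis length_Suc_conv_rev)
    with Suc show ?case by (simp add: G_snoc tree_auts_length[OF \<alpha>] tree_auts_length[OF \<beta>])
  qed
  have tl: "tl (G p t) = G p (tl t)" for p t
  proof (induction "length t" arbitrary: p t)
    case 0
    then show ?case by (simp add: G_Nil)
  next
    case (Suc n)
    then obtain u l where t: "t = u @ [l]" by (metis length_Suc_conv_rev)
    have "tl (G (c p l) (\<beta> p l u)) = G (c p l) (tl (\<beta> p l u))"
      using Suc t by (simp add: tree_auts_length[OF \<beta>])
    moreover have "\<alpha> p l (G (c p l) (\<beta> p l u)) = [] \<longleftrightarrow> u = []"
      using \<alpha> \<beta> len by (metis length_0_conv tree_auts_length)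
    ultimately show ?case
      using \<alpha> \<beta> by (simp add: t G_snoc G_Nil tl_snoc tree_auts_tl)
  qed
  have inj: "G p t = G p t' \<Longrightarrow> t = t'" for p t t'
  proof (induction "length t" arbitrary: p t t')
    case 0
    then show ?case by (metis len length_0_conv)
  next
    case (Suc n)
    have "length t' = Suc n" using Suc.hyps(2) Suc.prems by (metis len)
    with Suc.hyps(2) obtain u l u' l' where t: "t = u @ [l]" "t' = u' @ [l']"
      by (metis length_Suc_conv_rev)
    have l: "l' = l"
      using Suc.prems unfolding t G_snoc by (metis add_right_cancel append1_eq_conv)
    have "\<alpha> p l (G (c p l) (\<beta> p l u)) = \<alpha> p l (G (c p l) (\<beta> p l u'))"
      using Suc.prems by (simp add: t l G_snoc)
    then have "G (c p l) (\<beta> p l u) = G (c p l) (\<beta> p l u')"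
      using tree_auts_inj[OF \<alpha>] by (simp add: inj_eq)
    moreover have "n = length (\<beta> p l u)"
      using Suc.hyps(2) t by (simp add: tree_auts_length[OF \<beta>])
    ultimately have "\<beta> p l u = \<beta> p l u'" using Suc.hyps(1) by blast
    then show ?case
      using tree_auts_inj[OF \<beta>] by (simp add: t l inj_eq)
  qed
  have "G p \<in> tree_auts" for p
    by (intro tree_autsI len tl injI) (rule inj)
  with G_snoc show ?thesis using that by blast
qed

text \<open>The children of \<open>w\<close> may come in either order because conjugation by
  \<open>\<sigma>\<close> exchanges them.\<close>

definition conj_split :: "((word \<Rightarrow> word) \<times> (word \<Rightarrow> word)) set \<Rightarrow> (word \<Rightarrow> word) \<Rightarrow> (word \<Rightarrow> word) \<Rightarrow> bool" where
  "conj_split R v w \<longleftrightarrow> (\<exists>v0 v1 w0 w1. (v0, w0) \<in> R \<and> (v1, w1) \<in> R \<and>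
     v = wpair v0 v1 \<and> (w = wpair w0 w1 \<or> w = wpair w1 w0))"

definition conj_fuse :: "((word \<Rightarrow> word) \<times> (word \<Rightarrow> word)) set \<Rightarrow> (word \<Rightarrow> word) \<Rightarrow> (word \<Rightarrow> word) \<Rightarrow> bool" where
  "conj_fuse R v w \<longleftrightarrow> (\<exists>v0\<in>tree_auts. \<exists>v1\<in>tree_auts. \<exists>w0\<in>tree_auts. \<exists>w1\<in>tree_auts.
     (v0 \<circ> v1, w0 \<circ> w1) \<in> R \<and> v = wpair v0 v1 \<circ> \<sigma> \<and> w = wpair w0 w1 \<circ> \<sigma>)"

text \<open>The conjugator is built level by level: if \<open>g\<close> conjugates \<open>v\<^sub>0v\<^sub>1\<close> to \<open>w\<^sub>0w\<^sub>1\<close>, then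
  \<open>(g, w\<^sub>0\<^sup>-\<^sup>1 g v\<^sub>0)\<close> conjugates \<open>(v\<^sub>0, v\<^sub>1)\<sigma>\<close> to \<open>(w\<^sub>0, w\<^sub>1)\<sigma>\<close>.\<close>

lemma conj_coinduct:
  assumes aut: "\<And>v w. (v, w) \<in> R \<Longrightarrow> v \<in> tree_auts \<and> w \<in> tree_auts"
    and step: "\<And>v w. (v, w) \<in> R \<Longrightarrow> conj_split R v w \<or> conj_fuse R v w"
    and vw: "(v, w) \<in> R"
  obtains g where "g \<in> tree_auts" "g \<circ> v = w \<circ> g"
proof -
  \<comment> \<open>The tuple holds the data of one level of \<open>tree_auts_recursion\<close>.
    Here the conjugators of the paired children act on the subtrees, and \<open>e = 1\<close>
    exchanges these.\<close>
  define is_split where "is_split = (\<lambda>v w (e :: bit, c :: bit \<Rightarrow> (word \<Rightarrow> word) \<times> (word \<Rightarrow> word), \<alpha> :: bit \<Rightarrow> word \<Rightarrow> word, \<beta> :: bit \<Rightarrow> word \<Rightarrow> word).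
    \<exists>v0 v1 w0 w1. (v0, w0) \<in> R \<and> (v1, w1) \<in> R \<and> v = wpair v0 v1 \<and>
      w = (if e = 0 then wpair w0 w1 else wpair w1 w0) \<and>
      c = (\<lambda>l. if l = 0 then (v0, w0) else (v1, w1)) \<and> \<alpha> = (\<lambda>_. id) \<and> \<beta> = (\<lambda>_. id))"
  \<comment> \<open>\<open>u\<close> is the inverse of \<open>w0\<close>: if \<open>g\<close> is the
    conjugator of the products, then \<open>g\<close> stands over the letter 0 and
    \<open>u \<circ> g \<circ> v0\<close> over 1.\<close>
  define is_fuse where "is_fuse = (\<lambda>v w (e :: bit, c :: bit \<Rightarrow> (word \<Rightarrow> word) \<times> (word \<Rightarrow> word), \<alpha> :: bit \<Rightarrow> word \<Rightarrow> word, \<beta> :: bit \<Rightarrow> word \<Rightarrow> word).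
    \<exists>v0\<in>tree_auts. \<exists>v1 w0 w1. \<exists>u\<in>tree_auts. (v0 \<circ> v1, w0 \<circ> w1) \<in> R \<and> v = wpair v0 v1 \<circ> \<sigma> \<and>
      w = wpair w0 w1 \<circ> \<sigma> \<and> (\<forall>t. w0 (u t) = t \<and> u (w0 t) = t) \<and> e = 0 \<and>
      c = (\<lambda>_. (v0 \<circ> v1, w0 \<circ> w1)) \<and> \<alpha> = (\<lambda>l. if l = 0 then id else u) \<and>
      \<beta> = (\<lambda>l. if l = 0 then id else v0))"
  have ex_d: "\<exists>d. is_split v w d \<or> is_fuse v w d" if R: "(v, w) \<in> R" for v w
    using step[OF R]
  proof
    assume "conj_split R v w"
    then obtain v0 v1 w0 w1 and e :: bit where "(v0, w0) \<in> R" "(v1, w1) \<in> R" "v = wpair v0 v1"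
      "w = (if e = 0 then wpair w0 w1 else wpair w1 w0)"
      unfolding conj_split_def by (metis one_neq_zero)
    then have "is_split v w (e, \<lambda>l. if l = 0 then (v0, w0) else (v1, w1), \<lambda>_. id, \<lambda>_. id)"
      unfolding is_split_def prod.case by blast
    then show ?thesis by blast
  next
    assume "conj_fuse R v w"
    then obtain v0 v1 w0 w1 where *: "v0 \<in> tree_auts" "w0 \<in> tree_auts"
      "(v0 \<circ> v1, w0 \<circ> w1) \<in> R" "v = wpair v0 v1 \<circ> \<sigma>" "w = wpair w0 w1 \<circ> \<sigma>"
      unfolding conj_fuse_def by blast
    obtain u where "u \<in> tree_auts" "\<And>t. w0 (u t) = t" "\<And>t. u (w0 t) = t"
      using tree_auts_inverse[OF *(2)] by blast
    with * have "is_fuse v w (0, \<lambda>_. (v0 \<circ> v1, w0 \<circ> w1), \<lambda>l. if l = 0 then id else u,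
        \<lambda>l. if l = 0 then id else v0)"
      unfolding is_fuse_def prod.case by blast
    then show ?thesis by blast
  qed
  obtain D where D: "\<And>v w. (v, w) \<in> R \<Longrightarrow> is_split v w (D (v, w)) \<or> is_fuse v w (D (v, w))"
  proof -
    have "\<forall>p. \<exists>d. p \<in> R \<longrightarrow> is_split (fst p) (snd p) d \<or> is_fuse (fst p) (snd p) d"
      using ex_d by (metis prod.collapse)
    then show ?thesis using that by (metis fst_conv snd_conv)
  qed
  define e where "e p = fst (D p)" for p
  define c where "c p = fst (snd (D p))" for p
  \<comment> \<open>Outside \<open>R\<close> the identity is a default that keeps the hypotheses of
    the recursion true at every index.\<close>
  define \<alpha> where "\<alpha> p = (if p \<in> R then fst (snd (snd (D p))) else (\<lambda>_. id))" for p
  define \<beta> where "\<beta> p = (if p \<in> R then snd (snd (snd (D p))) else (\<lambda>_. id))" for p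
  have D': "is_split v w (e (v, w), c (v, w), \<alpha> (v, w), \<beta> (v, w)) \<or>
      is_fuse v w (e (v, w), c (v, w), \<alpha> (v, w), \<beta> (v, w))" if "(v, w) \<in> R" for v w
    using D[OF that] that by (simp add: e_def c_def \<alpha>_def \<beta>_def)
  have "\<alpha> p l \<in> tree_auts \<and> \<beta> p l \<in> tree_auts" for p l
  proof (cases "p \<in> R")
    case True
    then show ?thesis
      using D'[of "fst p" "snd p"] id_tree_auts unfolding is_split_def is_fuse_def prod.case prod.collapse
      by auto
  qed (simp add: \<alpha>_def \<beta>_def id_tree_auts)
  then obtain G where G_aut: "\<And>p. G p \<in> tree_auts"
    and G_snoc: "\<And>p t l. G p (t @ [l]) = \<alpha> p l (G (c p l) (\<beta> p l t)) @ [l + e p]"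
    using tree_auts_recursion[of \<alpha> \<beta> c e] by metis
  have "G (v, w) (v t) = w (G (v, w) t)" if "(v, w) \<in> R" for v w t
    using that
  proof (induction "length t" arbitrary: t v w)
    case 0
    then show ?case using aut[OF 0(2)] G_aut by (simp add: tree_auts_Nil)
  next
    case (Suc n)
    obtain u l where t: "t = u @ [l]" using Suc(2) by (metis length_Suc_conv_rev)
    have IH: "G (v', w') (v' u') = w' (G (v', w') u')" if "(v', w') \<in> R" "length u' = length u" for v' w' u'
      using Suc(1)[of u' v' w'] that Suc(2) t by simp
    consider "is_split v w (e (v, w), c (v, w), \<alpha> (v, w), \<beta> (v, w))"
      | "is_fuse v w (e (v, w), c (v, w), \<alpha> (v, w), \<beta> (v, w))" using D'[OF Suc(3)] by blast
    then show ?case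
    proof cases
      case 1
      then obtain v0 v1 w0 w1 where *: "(v0, w0) \<in> R" "(v1, w1) \<in> R" "v = wpair v0 v1"
        "w = (if e (v, w) = 0 then wpair w0 w1 else wpair w1 w0)"
        "c (v, w) = (\<lambda>l. if l = 0 then (v0, w0) else (v1, w1))"
        "\<alpha> (v, w) = (\<lambda>_. id)" "\<beta> (v, w) = (\<lambda>_. id)"
        unfolding is_split_def prod.case by blast
      have v: "v (u @ [l]) = (if l = 0 then v0 u else v1 u) @ [l]"
        by (simp add: *(3) wpair_snoc)
      have w: "w (u' @ [l + e (v, w)]) = (if l = 0 then w0 u' else w1 u') @ [l + e (v, w)]" for u'
        using bit_cases[of l] bit_cases[of "e (v, w)"] by (subst *(4)) (auto simp: wpair_snoc)
      show ?thesis
        unfolding t v G_snoc w *(5-7) using IH *(1,2) by simp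
    next
      case 2
      then obtain v0 v1 w0 w1 u' where *: "v0 \<in> tree_auts" "(v0 \<circ> v1, w0 \<circ> w1) \<in> R"
        "v = wpair v0 v1 \<circ> \<sigma>" "w = wpair w0 w1 \<circ> \<sigma>" "\<And>t. w0 (u' t) = t" "\<And>t. u' (w0 t) = t"
        "e (v, w) = 0" "c (v, w) = (\<lambda>_. (v0 \<circ> v1, w0 \<circ> w1))"
        "\<alpha> (v, w) = (\<lambda>l. if l = 0 then id else u')" "\<beta> (v, w) = (\<lambda>l. if l = 0 then id else v0)"
        unfolding is_fuse_def prod.case by blast
      have v: "v (u @ [l]) = (if l = 0 then v1 u else v0 u) @ [l + 1]"
        using bit_cases[of l] by (auto simp: *(3) wpair_snoc sigma_snoc)
      have w: "w (u' @ [l]) = (if l = 0 then w1 u' else w0 u') @ [l + 1]" for u'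
        using bit_cases[of l] by (auto simp: *(4) wpair_snoc sigma_snoc)
      have "G (v0 \<circ> v1, w0 \<circ> w1) (v0 (v1 u)) = w0 (w1 (G (v0 \<circ> v1, w0 \<circ> w1) u))"
        using IH[OF *(2), of u] by simp
      then show ?thesis
        unfolding t v G_snoc *(7-10) add_0_right w using *(5,6) bit_cases[of l] by auto
    qed
  qed
  then have "G (v, w) \<circ> v = w \<circ> G (v, w)" using vw by auto
  with G_aut show ?thesis using that by blast
qed

section \<open>Words in the generators\<close>

locale preperiodic =
  fixes r s :: nat
  assumes s_pos: "0 < s" and s_less: "s < r"
begin

primrec ev :: "(nat \<Rightarrow> bit) \<Rightarrow> nat list \<Rightarrow> word \<Rightarrow> word" where
  "ev x [] = id"
| "ev x (i # xs) = gens_fun r s x i \<circ> ev x xs"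

text \<open>Call the side \<open>x i\<close> active. There a letter above 1 drops by one, except
  that \<open>s + 1\<close> returns to \<open>r\<close>; on the other side only \<open>s + 1\<close>
  leaves something.\<close>

definition letter_sec :: "(nat \<Rightarrow> bit) \<Rightarrow> nat \<Rightarrow> bit \<Rightarrow> nat list" where
  "letter_sec x i l = (if i = 1 then [] else if i = s + 1 then (if l = x i then [r] else [s])
     else if l = x i then [i - 1] else [])"

definition out_bit :: "nat list \<Rightarrow> bit \<Rightarrow> bit" where
  "out_bit xs l = (if even (count_list xs 1) then l else l + 1)"

text \<open>The rightmost letters act first, so \<open>i\<close> meets \<open>out_bit xs l\<close>
  rather than \<open>l\<close>.\<close>

primrec sec :: "(nat \<Rightarrow> bit) \<Rightarrow> nat list \<Rightarrow> bit \<Rightarrow> nat list" where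
  "sec x [] l = []"
| "sec x (i # xs) l = letter_sec x i (out_bit xs l) @ sec x xs l"

definition desc_words :: "(nat \<Rightarrow> bit) \<Rightarrow> nat list \<Rightarrow> nat list set" where
  "desc_words x xs = (if even (count_list xs 1) then range (sec x xs) else {sec x xs 1 @ sec x xs 0})"

text \<open>Letters above \<open>s\<close> circulate through the range from \<open>s + 1\<close> to
  \<open>r\<close>, whereas the others descend to 1 and vanish; so the former can be
  conserved.\<close>

definition mark_count :: "nat list \<Rightarrow> nat" where
  "mark_count xs = length (filter ((<) s) xs)"

text \<open>The only letter whose two sections can contain the letter \<open>i\<close>.\<close>

definition pred :: "nat \<Rightarrow> nat" where
  "pred i = (if i = r then s + 1 else i + 1)"

lemma ev_append: "ev x (xs @ ys) = ev x xs \<circ> ev x ys"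
  by (induction xs) auto

lemma ev_tree_auts: "ev x xs \<in> tree_auts"
  by (induction xs) (simp_all only: ev.simps id_tree_auts comp_tree_auts gens_fun_in)

lemma gens_fun_letter:
  "gens_fun r s x i (t @ [l]) = ev x (letter_sec x i l) t @ [if i = 1 then l + 1 else l]"
  using bit_cases[of l] by (auto simp: gens_fun_snoc letter_sec_def sigma_snoc)

lemma ev_snoc: "ev x xs (t @ [l]) = ev x (sec x xs l) t @ [out_bit xs l]"
proof (induction xs)
  case (Cons i xs)
  then show ?case
    using bit_cases[of l] by (auto simp: gens_fun_letter ev_append out_bit_def)
qed (simp add: out_bit_def)

lemma ev_even:
  assumes "even (count_list xs 1)"
  shows "ev x xs = wpair (ev x (sec x xs 0)) (ev x (sec x xs 1))"
proof (rule word_eqI)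
  have out: "out_bit xs l = l" for l
    using assms by (simp only: out_bit_def if_True)
  show "ev x xs (t @ [l]) = wpair (ev x (sec x xs 0)) (ev x (sec x xs 1)) (t @ [l])" for t l
    unfolding ev_snoc out wpair_snoc using bit_cases[of l] by (cases "l = 0") simp_all
qed (simp add: ev_tree_auts tree_auts_Nil)

lemma ev_odd:
  assumes "odd (count_list xs 1)"
  shows "ev x xs = wpair (ev x (sec x xs 1)) (ev x (sec x xs 0)) \<circ> \<sigma>"
proof (rule word_eqI)
  have out: "out_bit xs 0 = 1" "out_bit xs 1 = 0"
    using assms by (simp_all add: out_bit_def)
  show "ev x xs (t @ [l]) = (wpair (ev x (sec x xs 1)) (ev x (sec x xs 0)) \<circ> \<sigma>) (t @ [l])" for t l
  proof (cases "l = 0")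
    case True
    show ?thesis unfolding True ev_snoc out comp_apply sigma_simps wpair_simps ..
  next
    case False
    then have "l = 1" using bit_cases by blast
    then show ?thesis by (simp only: ev_snoc out comp_apply sigma_simps wpair_simps)
  qed
qed (simp add: ev_tree_auts tree_auts_Nil)

lemma ev_eq_even_iff: "ev x xs = ev y ys \<Longrightarrow> even (count_list xs 1) \<longleftrightarrow> even (count_list ys 1)"
  using ev_even ev_odd wpair_neq_sigma by metis

lemma desc_words_even: "even (count_list xs 1) \<Longrightarrow> desc_words x xs = {sec x xs 0, sec x xs 1}"
proof -
  have "(UNIV :: bit set) = {0, 1}"
    using bit_cases by blast
  then have "range f = {f 0, f 1}" for f :: "bit \<Rightarrow> nat list"
    by (metis image_empty image_insert)
  then show "even (count_list xs 1) \<Longrightarrow> desc_words x xs = {sec x xs 0, sec x xs 1}"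
    by (simp add: desc_words_def)
qed

text \<open>Uniqueness of the wreath decomposition makes any word for an element yield exactly its
  first descendants, so chains of descendants lift to words.\<close>

lemma first_desc_ev: "first_desc (ev x xs) = ev x ` desc_words x xs"
proof (cases "even (count_list xs 1)")
  case True
  show ?thesis
    unfolding first_desc_def ev_even[OF True] desc_words_even[OF True] carrier_AutT mult_AutT
      wpair_eq_iff using wpair_neq_sigma ev_tree_auts by auto
next
  case False
  then have "desc_words x xs = {sec x xs 1 @ sec x xs 0}"
    by (simp add: desc_words_def)
  then show ?thesis
    unfolding first_desc_def ev_odd[OF False] carrier_AutT mult_AutT wpair_sigma_eq_iff
    using wpair_neq_sigma[symmetric] ev_tree_auts by (auto simp: ev_append)
qed

section \<open>The groups \<open>\<Gamma> r s x\<close> in terms of words\<close>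

lemma gens_fun_involution: "gens_fun r s x i (gens_fun r s x i t) = t"
proof (induction t arbitrary: i rule: rev_induct)
  case (snoc l t)
  then show ?case
    using bit_cases[of l] by (auto simp: gens_fun_letter letter_sec_def)
qed simp

lemma ev_replicate: "ev x (replicate n i) = (if even n then id else gens_fun r s x i)"
  by (induction n) (auto simp: gens_fun_involution)

lemma gens_eq: "i \<in> {1..r} \<Longrightarrow> gens r s x i = gens_fun r s x i"
  using recursion_relations_unique[OF s_pos s_less gens_recursion_relations[OF s_pos s_less]
      recursion_relations_exists[OF s_pos s_less]]
  by (simp add: restrict_def)

lemma ev_in_\<Gamma>: "set xs \<subseteq> {1..r} \<Longrightarrow> ev x xs \<in> \<Gamma> r s x"
proof (induction xs)
  case Nil
  show ?case unfolding ev.simps \<Gamma>_def one_AutT[symmetric] by (rule generate.one)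
next
  case (Cons i xs)
  then have "gens_fun r s x i \<in> \<Gamma> r s x"
    unfolding \<Gamma>_def by (intro generate.incl) (auto simp: gens_eq[symmetric] simp del: atLeastAtMost_iff)
  with Cons show ?case
    unfolding \<Gamma>_def ev.simps mult_AutT[symmetric] by (intro generate.eng) auto
qed

text \<open>The generators are involutions, so inverses are positive words too.\<close>

lemma \<Gamma>_ev:
  assumes "w \<in> \<Gamma> r s x"
  obtains xs where "set xs \<subseteq> {1..r}" "w = ev x xs"
proof -
  have "\<exists>xs. set xs \<subseteq> {1..r} \<and> w = ev x xs"
    using assms unfolding \<Gamma>_def
  proof (induction rule: generate.induct)
    case one
    then show ?case by (auto intro: exI[of _ "[]"])
  next
    case (incl h)
    then obtain i where "i \<in> {1..r}" "h = gens_fun r s x i" using gens_eq by auto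
    then show ?case by (auto intro!: exI[of _ "[i]"])
  next
    case (inv h)
    then obtain i where i: "i \<in> {1..r}" "h = gens_fun r s x i" using gens_eq by auto
    have "inv\<^bsub>AutT\<^esub> h = h"
      unfolding i by (rule group.inv_equality[OF group_AutT]) (auto simp: gens_fun_in fun_eq_iff gens_fun_involution)
    with i show ?case by (auto intro!: exI[of _ "[i]"])
  next
    case (eng h1 h2)
    then obtain xs ys where "set xs \<subseteq> {1..r}" "h1 = ev x xs" "set ys \<subseteq> {1..r}" "h2 = ev x ys"
      by blast
    then have "set (xs @ ys) \<subseteq> {1..r}" "h1 \<otimes>\<^bsub>AutT\<^esub> h2 = ev x (xs @ ys)"
      by (simp_all add: ev_append)
    then show ?case by blast
  qed
  with that show ?thesis by blast
qed

section \<open>Letter and mark counts in the two sections\<close>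

lemma out_bit_neq: "l \<noteq> l' \<Longrightarrow> out_bit xs l \<noteq> out_bit xs l'"
  unfolding out_bit_def by (metis add_right_cancel)

lemma letter_sec_letters: "i \<in> {1..r} \<Longrightarrow> set (letter_sec x i l) \<subseteq> {1..r}"
  using s_pos s_less by (auto simp: letter_sec_def)

lemma sec_letters: "set xs \<subseteq> {1..r} \<Longrightarrow> set (sec x xs l) \<subseteq> {1..r}"
proof (induction xs)
  case (Cons i xs)
  then show ?case using letter_sec_letters[of i x "out_bit xs l"] by simp
qed simp

lemma desc_words_letters: "ys \<in> desc_words x xs \<Longrightarrow> set xs \<subseteq> {1..r} \<Longrightarrow> set ys \<subseteq> {1..r}"
  using sec_letters unfolding desc_words_def by (metis Un_least imageE set_append singletonD)

lemma letter_sec_active: "letter_sec x k (x k) = (if k = 1 then [] else if k = s + 1 then [r] else [k - 1])"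
  by (simp add: letter_sec_def)

lemma letter_sec_inactive: "l \<noteq> x k \<Longrightarrow> letter_sec x k l = (if k = s + 1 then [s] else [])"
  using s_pos by (auto simp: letter_sec_def)

lemma bit_neq_cases:
  assumes "(l :: bit) \<noteq> l'"
  obtains "l = m" "l' \<noteq> m" | "l' = m" "l \<noteq> m"
  using assms bit_cases by metis

lemma letter_sec_total_count:
  assumes "l \<noteq> l'" "k \<in> {1..r}" "i \<in> {1..r}"
  shows "count_list (letter_sec x k l) i + count_list (letter_sec x k l') i = (if k = pred i then 1 else 0)"
proof -
  have "count_list (letter_sec x k (x k)) i + count_list (letter_sec x k l) i = (if k = pred i then 1 else 0)"
    if "l \<noteq> x k" for l
    unfolding letter_sec_active letter_sec_inactive[of l x k, OF that] pred_def
    using assms(2,3) s_pos s_less by auto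
  then show ?thesis
    using bit_neq_cases[OF assms(1), of "x k"] by (metis add.commute)
qed

text \<open>Distinct letters \<open>l\<close> and \<open>l'\<close> reach each generator as distinct
  letters, so it gives one of its two sections to each side; together these contain \<open>i\<close>
  once if the generator is \<open>pred i\<close>, and otherwise not at all.\<close>

lemma sec_total_count:
  assumes "l \<noteq> l'" "set xs \<subseteq> {1..r}" "i \<in> {1..r}"
  shows "count_list (sec x xs l) i + count_list (sec x xs l') i = count_list xs (pred i)"
  using assms(2)
proof (induction xs)
  case (Cons k xs)
  then show ?case
    using letter_sec_total_count[OF out_bit_neq[OF assms(1)], of k i x xs] assms(3) by (simp split: if_splits)
qed simp

lemma mark_count_append [simp]: "mark_count (xs @ ys) = mark_count xs + mark_count ys"
  by (simp add: mark_count_def)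

lemma letter_sec_total_mark_count:
  assumes "l \<noteq> l'" "k \<in> {1..r}"
  shows "mark_count (letter_sec x k l) + mark_count (letter_sec x k l') = mark_count [k]"
proof -
  have "mark_count (letter_sec x k (x k)) + mark_count (letter_sec x k l) = mark_count [k]"
    if "l \<noteq> x k" for l
    unfolding letter_sec_active letter_sec_inactive[of l x k, OF that] mark_count_def
    using assms(2) s_pos s_less by auto
  then show ?thesis
    using bit_neq_cases[OF assms(1), of "x k"] by (metis add.commute)
qed

text \<open>A marked letter passes one mark to its active side, unmarked letters have unmarked
  sections, and the \<open>s\<close> left by \<open>s + 1\<close> is unmarked.\<close>

lemma sec_total_mark_count:
  assumes "l \<noteq> l'" "set xs \<subseteq> {1..r}"
  shows "mark_count (sec x xs l) + mark_count (sec x xs l') = mark_count xs"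
  using assms(2)
proof (induction xs)
  case (Cons k xs)
  have "mark_count (k # xs) = mark_count [k] + mark_count xs"
    by (simp add: mark_count_def)
  with Cons show ?case
    using letter_sec_total_mark_count[OF out_bit_neq[OF assms(1)], of k x xs] by simp
qed (simp add: mark_count_def)

lemma sec_desc_words:
  assumes "ys \<in> desc_words x xs"
  obtains (even) l where "even (count_list xs 1)" "ys = sec x xs l"
    | (odd) "odd (count_list xs 1)" "ys = sec x xs 1 @ sec x xs 0"
  using assms that by (auto simp: desc_words_def split: if_splits)

lemma desc_words_mark_count:
  assumes "ys \<in> desc_words x xs" "set xs \<subseteq> {1..r}"
  shows "mark_count ys \<le> mark_count xs"
  using assms(1)
proof (cases rule: sec_desc_words)
  case (even l)
  then show ?thesis using sec_total_mark_count[OF bit_neq_succ assms(2), of x l] even(2) by simp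
next
  case odd
  then show ?thesis using sec_total_mark_count[of 1 0, OF _ assms(2), of x] by simp
qed

lemma desc_words_count:
  assumes "ys \<in> desc_words x xs" "set xs \<subseteq> {1..r}" "i \<in> {1..r}"
  shows "count_list ys i \<le> count_list xs (pred i)"
  using assms(1)
proof (cases rule: sec_desc_words)
  case (even l)
  then show ?thesis using sec_total_count[OF bit_neq_succ assms(2,3), of x l] even(2) by simp
next
  case odd
  then show ?thesis using sec_total_count[of 1 0, OF _ assms(2,3), of x] by simp
qed

section \<open>Finiteness of the set of descendants\<close>

lemma nth_desc_ev:
  assumes "y \<in> nth_desc n (ev x xs)" "set xs \<subseteq> {1..r}" "\<And>i. count_list xs i \<le> m"
  shows "\<exists>ys. y = ev x ys \<and> set ys \<subseteq> {1..r} \<and> (\<forall>i. count_list ys i \<le> m)"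
  using assms(1)
proof (induction n arbitrary: y)
  case 0
  then show ?case using assms by auto
next
  case (Suc n)
  then obtain z where "z \<in> nth_desc n (ev x xs)" "y \<in> first_desc z" by auto
  then obtain zs ys where *: "set zs \<subseteq> {1..r}" "\<And>i. count_list zs i \<le> m" "ys \<in> desc_words x zs" "y = ev x ys"
    using Suc.IH by (metis first_desc_ev imageE)
  have "count_list ys i \<le> m" for i
  proof (cases "i \<in> {1..r}")
    case True
    then show ?thesis using desc_words_count[OF *(3,1)] *(2) order_trans by blast
  next
    case False
    then show ?thesis using desc_words_letters[OF *(3,1)] by (metis count_notin le0 subset_eq)
  qed
  moreover have "set ys \<subseteq> {1..r}"
    using desc_words_letters * by blast
  ultimately show ?case
    using *(4) by blast
qed

text \<open>Multiplicities of letters stay bounded along descendants, which bounds the length of the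
  words. Irreducibility thus reduces to recurrence.\<close>

lemma finite_Desc_ev:
  assumes "set xs \<subseteq> {1..r}"
  shows "finite (Desc (ev x xs))"
proof -
  define X where "X = {ys. set ys \<subseteq> {1..r} \<and> length ys \<le> r * length xs}"
  have "length ys \<le> r * length xs" if "set ys \<subseteq> {1..r}" "\<And>i. count_list ys i \<le> length xs" for ys
  proof -
    have "length ys = (\<Sum>i\<in>{1..r}. count_list ys i)"
      using sum_count_set[OF that(1)] by simp
    also have "\<dots> \<le> (\<Sum>i\<in>{1..r}. length xs)"
      by (intro sum_mono that)
    finally show ?thesis by simp
  qed
  then have "nth_desc n (ev x xs) \<subseteq> ev x ` X" for n
    using nth_desc_ev[OF _ assms count_le_length] unfolding X_def by blast
  then have "Desc (ev x xs) \<subseteq> ev x ` X"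
    unfolding Desc_def by blast
  moreover have "finite X"
    unfolding X_def by (intro finite_lists_length_le) simp
  ultimately show ?thesis
    using finite_surj by blast
qed

section \<open>Sections of words without \<open>\<sigma>\<close>, and the birth of letters
  \<open>s\<close>\<close>

lemma sec_no_one: "1 \<notin> set xs \<Longrightarrow> sec x xs l = concat (map (\<lambda>k. letter_sec x k l) xs)"
  by (induction xs) (auto simp: out_bit_def)

lemma sec_constant_inactive:
  assumes "1 \<notin> set xs" "\<And>k. k \<in> set xs \<Longrightarrow> x k = l" "l \<noteq> l'"
  shows "sec x xs l' = replicate (count_list xs (s + 1)) s"
proof -
  have "concat (map (\<lambda>k. letter_sec x k l') xs) = replicate (count_list xs (s + 1)) s"
    using assms(2)
  proof (induction xs)
    case (Cons k xs)
    have "l' \<noteq> x k" using Cons(2)[of k] assms(3) by auto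
    then show ?case
      using Cons letter_sec_inactive[of l' x k] by simp
  qed simp
  then show ?thesis using sec_no_one[OF assms(1)] by simp
qed

text \<open>The inactive side takes all new letters \<open>s\<close> and nothing else; subtracting
  it from the total leaves the rest for the active side.\<close>

lemma sec_constant_count:
  assumes "1 \<notin> set xs" "\<And>k. k \<in> set xs \<Longrightarrow> x k = l" "set xs \<subseteq> {1..r}" "i \<in> {1..r}"
  shows "count_list (sec x xs l) i = (if i = s then 0 else count_list xs (pred i))"
proof -
  have "count_list (replicate m s) i = (if i = s then m else 0)" for m
    by (induction m) auto
  moreover have "pred s = s + 1"
    using s_less by (simp add: pred_def)
  ultimately show ?thesis
    using sec_total_count[OF bit_neq_succ assms(3,4), of x l]
      sec_constant_inactive[OF assms(1,2) bit_neq_succ] by auto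
qed

text \<open>On the active side \<open>s + 1\<close> becomes \<open>r\<close>, which differs from
  \<open>s\<close>. So a letter \<open>s\<close> is left by \<open>s + 1\<close> on its inactive
  side, opposite to that \<open>r\<close>.\<close>

lemma letter_sec_spawn:
  assumes "l \<noteq> l'" "k \<in> {1..r}" "s \<in> set (letter_sec x k l)"
  shows "r \<in> set (letter_sec x k l')"
proof -
  have "l \<noteq> x k"
  proof
    assume "l = x k"
    with assms(2,3) s_less show False
      using letter_sec_active[of x k] by (auto split: if_splits)
  qed
  then have "l' = x k" "k = s + 1"
    using assms(3) bit_neq_cases[OF assms(1), of "x k"] letter_sec_inactive[of l x k]
    by (auto split: if_splits)
  then show ?thesis using letter_sec_active[of x k] s_pos by simp
qed

lemma sec_spawn:
  assumes "l \<noteq> l'" "set xs \<subseteq> {1..r}" "s \<in> set (sec x xs l)"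
  shows "r \<in> set (sec x xs l')"
  using assms(2,3)
proof (induction xs)
  case (Cons k xs)
  then show ?case
    using letter_sec_spawn[OF out_bit_neq[OF assms(1), of xs], of k x] by auto
qed simp

lemma mark_count_eq_0: "mark_count xs = 0 \<longleftrightarrow> (\<forall>k\<in>set xs. k \<le> s)"
  by (auto simp: mark_count_def filter_empty_conv)

end

section \<open>Periodic sequences of words\<close>

text \<open>The words lifting a cycle of descendants are not assumed to repeat; periodicity is asked
  only of the parity that the automorphism itself determines.\<close>

locale periodic_words = preperiodic +
  fixes x :: "nat \<Rightarrow> bit" and z :: "nat \<Rightarrow> nat list" and n :: nat
  assumes letters: "set (z j) \<subseteq> {1..r}"
    and step: "z (Suc j) \<in> desc_words x (z j)"
    and marks: "mark_count (z (Suc j)) = mark_count (z j)"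
    and n_pos: "0 < n"
    and period: "odd (count_list (z (j + n)) 1) = odd (count_list (z j) 1)"
begin

section \<open>Swapping steps and the life of unmarked letters\<close>

definition swaps :: "nat \<Rightarrow> bool" where
  "swaps j \<longleftrightarrow> odd (count_list (z j) 1)"

text \<open>The chosen section keeps all marks, so the discarded one has none.\<close>

lemma not_swaps_sec:
  assumes "\<not> swaps j"
  obtains l where "z (Suc j) = sec x (z j) l" "\<And>k. k \<in> set (sec x (z j) (l + 1)) \<Longrightarrow> k \<le> s"
proof -
  obtain l where l: "z (Suc j) = sec x (z j) l"
    using step[of j] assms by (auto simp: desc_words_def swaps_def)
  have "mark_count (sec x (z j) (l + 1)) = 0"
    using sec_total_mark_count[OF bit_neq_succ letters[of j], of x l] marks[of j] l by simp
  then show ?thesis using that l mark_count_eq_0 by blast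
qed

lemma swaps_sec: "swaps j \<Longrightarrow> z (Suc j) = sec x (z j) 1 @ sec x (z j) 0"
  using step[of j] by (simp add: desc_words_def swaps_def)

lemma letter_shift:
  assumes "i \<in> {1..r}" "i \<in> set (z (Suc j))"
  shows "pred i \<in> set (z j)"
  using desc_words_count[OF step letters assms(1), of j] assms(2)
  by (metis count_list_0_iff le_zero_eq)

lemma letter_shifts:
  assumes "1 \<le> i" "i + d \<le> s" "i \<in> set (z (j + d))"
  shows "i + d \<in> set (z j)"
  using assms
proof (induction d arbitrary: i)
  case (Suc d)
  have "pred i \<in> set (z (j + d))"
    using letter_shift[of i "j + d"] Suc.prems s_less by simp
  moreover have "pred i = Suc i"
    using Suc.prems s_less by (simp add: pred_def)
  ultimately show ?case
    using Suc.IH[of "Suc i"] Suc.prems by simp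
qed simp

text \<open>At a non-swapping step, a new \<open>s\<close> on the chosen side would come with a
  marked \<open>r\<close> on the discarded side.\<close>

lemma spawn_swaps: "s \<in> set (z (Suc j)) \<Longrightarrow> swaps j"
proof (rule ccontr)
  assume s: "s \<in> set (z (Suc j))" and "\<not> swaps j"
  then obtain l where "z (Suc j) = sec x (z j) l" "\<And>k. k \<in> set (sec x (z j) (l + 1)) \<Longrightarrow> k \<le> s"
    using not_swaps_sec by metis
  then show False
    using sec_spawn[where x = x and l = l, OF bit_neq_succ letters[of j]] s s_less by force
qed

text \<open>Unmarked letters descend by one per step, so this \<open>i\<close> goes back to a letter
  \<open>s\<close> born at step \<open>j\<close>.\<close>

lemma letter_swaps_birth:
  assumes "i \<in> {1..s}" "i \<in> set (z (Suc (j + (s - i))))"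
  shows "swaps j"
  using letter_shifts[of i "s - i" "Suc j"] assms spawn_swaps by simp

lemma swaps_add_s: "swaps (j + s) \<longleftrightarrow> swaps j"
proof -
  have swaps_sub: "swaps j" if "swaps (j + s)" for j
  proof -
    have "1 \<in> set (z (j + s))"
      using that count_notin by (force simp: swaps_def)
    then show ?thesis using letter_swaps_birth[of 1 j] s_pos by simp
  qed
  have swaps_sub_mult: "swaps j" if "swaps (j + s * k)" for j k
    using that
  proof (induction k)
    case (Suc k)
    then show ?case using swaps_sub[of "j + s * k"] by (simp add: ac_simps)
  qed simp
  have forth: "swaps (j + n * k) = swaps j" for k
  proof (induction k)
    case (Suc k)
    then show ?case using period[of "j + n * k"] by (simp add: swaps_def ac_simps)
  qed simp
  have "swaps (j + s)" if "swaps j"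
  proof (rule swaps_sub_mult)
    \<comment> \<open>Periodicity carries the swap from \<open>j\<close> to
      \<open>j + n * s\<close>; going back from there in strides of \<open>s\<close> reaches
      \<open>j + s\<close>.\<close>
    have "j + s + s * (n - 1) = j + n * s"
      using n_pos by (cases n) (auto simp: algebra_simps)
    then show "swaps (j + s + s * (n - 1))" using that forth[of s] by metis
  qed
  with swaps_sub show ?thesis by blast
qed

text \<open>From index \<open>s\<close> on, the birth step of the letter lies within the sequence,
  \<open>s - i + 1\<close> steps earlier. It swaps, and so does the step \<open>s\<close>
  later.\<close>

lemma letter_swaps_later:
  assumes "s \<le> j" "i \<in> {1..s}" "i \<in> set (z j)"
  shows "swaps (j + i - 1)"
proof -
  define j' where "j' = j - Suc (s - i)"
  have "j = Suc (j' + (s - i))" "j + i - 1 = j' + s"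
    using assms(1,2) by (auto simp: j'_def)
  then show ?thesis
    using letter_swaps_birth[of i j'] swaps_add_s[of j'] assms(2,3) by simp
qed

text \<open>Both claims rest on timing: an unmarked letter is due to become \<open>\<sigma>\<close>
  only at a swapping step, so in particular no \<open>\<sigma>\<close> is present now.\<close>

lemma not_swaps_constant:
  assumes "s \<le> j" "\<not> swaps j"
  obtains l where "z (Suc j) = sec x (z j) l" "1 \<notin> set (z j)" "\<And>k. k \<in> set (z j) \<Longrightarrow> x k = l"
proof -
  have one: "1 \<notin> set (z j)"
    using letter_swaps_later[of j 1] assms s_pos by auto
  obtain l where l: "z (Suc j) = sec x (z j) l" "\<And>k. k \<in> set (sec x (z j) (l + 1)) \<Longrightarrow> k \<le> s"
    using not_swaps_sec[OF assms(2)] by metis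
  have "x k = l" if k: "k \<in> set (z j)" for k
  proof (rule ccontr)
    assume neq: "x k \<noteq> l"
    have k1: "k \<noteq> 1" "k \<in> {1..r}" using one k letters[of j] by (metis, blast)
    show False
    proof (cases "s < k")
      case True
      \<comment> \<open>The active section of a marked letter is marked, so it would put a mark on
        the discarded side.\<close>
      have "set (letter_sec x k (x k)) \<subseteq> set (sec x (z j) (l + 1))"
        unfolding sec_no_one[OF one] using k neq bit_neq_iff[of "x k" l] by auto
      then show False
        using l(2) k1 True s_less letter_sec_active[of x k] by (force split: if_splits)
    next
      case False
      \<comment> \<open>When \<open>k\<close> is due to become \<open>\<sigma>\<close>, the step
        swaps, so some \<open>\<sigma>\<close> is present; traced back to \<open>Suc j\<close>, it
        is a letter \<open>k - 1\<close> on the chosen side.\<close>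
      then have "swaps (j + k - 1)"
        using letter_swaps_later[of j k] assms(1) k k1 by simp
      then have "1 \<in> set (z (j + k - 1))"
        using count_notin by (force simp: swaps_def)
      moreover have "j + k - 1 = Suc j + (k - 2)" using k1 by auto
      moreover have "1 + (k - 2) \<le> s"
        using False s_pos by auto
      ultimately have "1 + (k - 2) \<in> set (z (Suc j))"
        using letter_shifts[OF order_refl, of "k - 2" "Suc j"] by metis
      moreover have "1 + (k - 2) = k - 1" using k1 by auto
      \<comment> \<open>As \<open>k - 1\<close> lies below \<open>s\<close>, its source can only be
        \<open>k\<close> itself, on its active side.\<close>
      ultimately obtain k' where k': "k' \<in> set (z j)" "k - 1 \<in> set (letter_sec x k' l)"
        unfolding l(1) sec_no_one[OF one] by auto
      have "k' \<noteq> 0" using k'(1) letters[of j] by force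
      have "k - 1 = k' - 1" "l = x k'"
        using k'(2) k1 False s_less by (auto simp: letter_sec_def split: if_splits)
      with \<open>k' \<noteq> 0\<close> k1 neq show False by (cases k; cases k') auto
    qed
  qed
  with l(1) one show ?thesis using that by blast
qed

text \<open>The tuple drops out: a swapping step keeps both sections, and any other discards exactly
  the newborn letters \<open>s\<close>.\<close>

lemma count_step:
  assumes "s \<le> j" "i \<in> {1..r}"
  shows "count_list (z (Suc j)) i = (if i = s \<and> \<not> swaps j then 0 else count_list (z j) (pred i))"
proof (cases "swaps j")
  case True
  then show ?thesis
    using swaps_sec sec_total_count[of 1 0, OF _ letters assms(2), of x j] by simp
next
  case False
  obtain l where "z (Suc j) = sec x (z j) l" "1 \<notin> set (z j)" "\<And>k. k \<in> set (z j) \<Longrightarrow> x k = l"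
    using not_swaps_constant[OF assms(1) False] by metis
  then show ?thesis
    using sec_constant_count[OF _ _ letters assms(2)] False by simp
qed

section \<open>Coupling with words for the tuple 0\<close>

definition coupled :: "nat \<Rightarrow> nat list \<Rightarrow> bool" where
  "coupled j ys \<longleftrightarrow> set ys \<subseteq> {1..r} \<and> (\<forall>i\<in>{1..r}. count_list ys i = count_list (z j) i mod 2)"

abbreviation x0 :: "nat \<Rightarrow> bit" where "x0 \<equiv> \<lambda>_. 0"

text \<open>For the tuple 0, side 0 is the active side of every letter.\<close>

definition next_word :: "nat list \<Rightarrow> nat list" where
  "next_word ys = (if odd (count_list ys 1) then sec x0 ys 1 @ sec x0 ys 0 else sec x0 ys 0)"

lemma next_word_desc: "next_word ys \<in> desc_words x0 ys"
  by (simp add: next_word_def desc_words_def)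

text \<open>Each letter of odd count is taken once; the order is immaterial, since only parities are
  compared.\<close>

lemma coupled_exists: "\<exists>ys. coupled j ys"
proof -
  define ys where "ys = filter (\<lambda>i. odd (count_list (z j) i)) [1..<Suc r]"
  have "distinct ys" "set ys = {i \<in> {1..r}. odd (count_list (z j) i)}"
    by (auto simp: ys_def)
  moreover have "distinct ys \<Longrightarrow> count_list ys i = (if i \<in> set ys then 1 else 0)" for i
    by (induction ys) auto
  ultimately have "coupled j ys"
    by (auto simp: coupled_def odd_iff_mod_2_eq_one)
  then show ?thesis by blast
qed

lemma coupled_odd: "coupled j ys \<Longrightarrow> odd (count_list ys 1) \<longleftrightarrow> swaps j"
  using s_pos s_less by (simp add: coupled_def swaps_def)

lemma coupled_no_one: "coupled j ys \<Longrightarrow> \<not> swaps j \<Longrightarrow> 1 \<notin> set ys"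
  using s_pos s_less count_list_0_iff[of ys 1]
  by (simp add: coupled_def swaps_def even_iff_mod_2_eq_zero)

text \<open>Both words follow the rule of \<open>count_step\<close>, which only copies counts or
  sets them to 0 and so commutes with reduction modulo 2.\<close>

lemma coupled_next:
  assumes "s \<le> j" "coupled j ys"
  shows "coupled (Suc j) (next_word ys)"
proof -
  have ys: "set ys \<subseteq> {1..r}" using assms(2) by (simp add: coupled_def)
  have "count_list (next_word ys) i = (if i = s \<and> \<not> swaps j then 0 else count_list ys (pred i))"
    if i: "i \<in> {1..r}" for i
  proof (cases "swaps j")
    case True
    then show ?thesis
      using coupled_odd[OF assms(2)] sec_total_count[of 1 0, OF _ ys i, of x0] by (simp add: next_word_def)
  next
    case False
    then show ?thesis
      using coupled_odd[OF assms(2)] coupled_no_one[OF assms(2)] sec_constant_count[of ys x0 0 i] ys i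
      by (simp add: next_word_def)
  qed
  moreover have "pred i \<in> {1..r}" if "i \<in> {1..r}" for i
    using that s_less by (auto simp: pred_def)
  ultimately show ?thesis
    using assms(2) desc_words_letters[OF next_word_desc ys] count_step[OF assms(1)]
    by (simp add: coupled_def)
qed

text \<open>Besides coupled words, the relation must contain the powers of generator
  \<open>s\<close> split off on discarded sides, together with their descendants.\<close>

definition conj_rel :: "((word \<Rightarrow> word) \<times> (word \<Rightarrow> word)) set" where
  "conj_rel = {(ev x0 ys, ev x (z j)) | j ys. s \<le> j \<and> coupled j ys} \<union>
     {(gens_fun r s x0 i, gens_fun r s x i) | i. i \<in> {1..s}} \<union> {(id, id)}"

lemma conj_rel_step:
  assumes "(v, w) \<in> conj_rel"
  shows "conj_split conj_rel v w \<or> conj_fuse conj_rel v w"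
proof -
  have id: "(id, id) \<in> conj_rel" by (simp add: conj_rel_def)
  have gen: "(gens_fun r s x0 i, gens_fun r s x i) \<in> conj_rel" if "i \<in> {1..s}" for i
    using that by (auto simp: conj_rel_def)
  have wpair_id: "wpair id id = id"
    by (rule word_eqI) (simp_all add: wpair_snoc)
  consider (word) j ys where "s \<le> j" "coupled j ys" "v = ev x0 ys" "w = ev x (z j)"
    | (gen) i where "i \<in> {1..s}" "v = gens_fun r s x0 i" "w = gens_fun r s x i"
    | (id) "v = id" "w = id"
    using assms by (auto simp: conj_rel_def)
  then show ?thesis
  proof cases
    case word
    have "(ev x0 (next_word ys), ev x (z (Suc j))) \<in> conj_rel"
      using coupled_next[OF word(1,2)] word(1) unfolding conj_rel_def by (auto intro: le_SucI)
    note rel = this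
    show ?thesis
    proof (cases "swaps j")
      case True
      then have odd: "odd (count_list ys 1)" "odd (count_list (z j) 1)"
        using coupled_odd[OF word(2)] by (simp_all add: swaps_def)
      then have "(ev x0 (sec x0 ys 1) \<circ> ev x0 (sec x0 ys 0), ev x (sec x (z j) 1) \<circ> ev x (sec x (z j) 0)) \<in> conj_rel"
        using rel swaps_sec[OF True] by (simp add: next_word_def ev_append)
      then have "conj_fuse conj_rel v w"
        unfolding conj_fuse_def word(3,4) using ev_odd[OF odd(1), of x0] ev_odd[OF odd(2), of x] ev_tree_auts
        by blast
      then show ?thesis ..
    next
      case False
      then have even: "even (count_list ys 1)" "even (count_list (z j) 1)"
        using coupled_odd[OF word(2)] by (simp_all add: swaps_def)
      obtain l where l: "z (Suc j) = sec x (z j) l" "1 \<notin> set (z j)" "\<And>k. k \<in> set (z j) \<Longrightarrow> x k = l"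
        using not_swaps_constant[OF word(1) False] by metis
      \<comment> \<open>The discarded sides are powers of the involution of index \<open>s\<close>
        with exponents of equal parity: both the identity or both that generator.\<close>
      have "s + 1 \<in> {1..r}" using s_less by simp
      then have parity: "even (count_list ys (s + 1)) \<longleftrightarrow> even (count_list (z j) (s + 1))"
        using word(2) unfolding coupled_def by (metis even_mod_2_iff)
      have "(ev x0 (replicate (count_list ys (s + 1)) s), ev x (replicate (count_list (z j) (s + 1)) s)) \<in> conj_rel"
        using id gen[of s] s_pos parity by (simp add: ev_replicate)
      moreover have "sec x0 ys 1 = replicate (count_list ys (s + 1)) s"
        using sec_constant_inactive[of ys x0 0 1] coupled_no_one[OF word(2) False] by simp
      ultimately have rel': "(ev x0 (sec x0 ys 1), ev x (sec x (z j) (l + 1))) \<in> conj_rel"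
        using sec_constant_inactive[OF l(2,3) bit_neq_succ] by simp
      have "(ev x0 (sec x0 ys 0), ev x (sec x (z j) l)) \<in> conj_rel"
        using rel l(1) even(1) by (simp add: next_word_def)
      \<comment> \<open>For \<open>l = 1\<close> the sides of \<open>w\<close> stand in the opposite
        order, which \<open>conj_split\<close> allows.\<close>
      moreover have "w = wpair (ev x (sec x (z j) l)) (ev x (sec x (z j) (l + 1))) \<or>
          w = wpair (ev x (sec x (z j) (l + 1))) (ev x (sec x (z j) l))"
        using ev_even[OF even(2), of x] bit_cases[of l] word(4) by auto
      ultimately have "conj_split conj_rel v w"
        unfolding conj_split_def word(3) using ev_even[OF even(1), of x0] rel' by blast
      then show ?thesis ..
    qed
  next
    case gen
    show ?thesis
    proof (cases "i = 1")
      case True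
      have "gens_fun r s x i = wpair id id \<circ> \<sigma>" for x
        unfolding wpair_id True by (rule word_eqI) (simp_all add: gens_fun_snoc)
      then have "conj_fuse conj_rel v w"
        unfolding conj_fuse_def gen(2,3) using id id_tree_auts by (metis comp_id)
      then show ?thesis ..
    next
      case False
      have "gens_fun r s x i = (if x i = 0 then wpair (gens_fun r s x (i - 1)) id
          else wpair id (gens_fun r s x (i - 1)))" for x
        using False gen(1) bit_cases[of "x i"]
        by (intro word_eqI) (auto simp: gens_fun_snoc wpair_snoc)
      moreover have "i - 1 \<in> {1..s}" using False gen(1) by auto
      ultimately have "conj_split conj_rel v w"
        unfolding conj_split_def gen(2,3) using id \<open>\<And>i. i \<in> {1..s} \<Longrightarrow> _ i\<close> by (metis (full_types))
      then show ?thesis ..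
    qed
  next
    case id
    then have "conj_split conj_rel v w"
      unfolding conj_split_def using wpair_id \<open>(id, id) \<in> conj_rel\<close> by metis
    then show ?thesis ..
  qed
qed

lemma coupled_conjugate:
  assumes "s \<le> j" "coupled j ys"
  obtains g where "g \<in> tree_auts" "g \<circ> ev x0 ys = ev x (z j) \<circ> g"
proof (rule conj_coinduct)
  show "(ev x0 ys, ev x (z j)) \<in> conj_rel"
    using assms by (auto simp: conj_rel_def)
  show "v \<in> tree_auts \<and> w \<in> tree_auts" if "(v, w) \<in> conj_rel" for v w
    using that by (auto simp: conj_rel_def ev_tree_auts gens_fun_in id_tree_auts)
qed (use conj_rel_step that in blast)+

lemma finite_coupled: "finite {ys. \<exists>j. coupled j ys}"
proof -
  have "length ys \<le> r" if "coupled j ys" for j ys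
  proof -
    have "length ys = (\<Sum>i\<in>{1..r}. count_list ys i)"
      using sum_count_set[of ys "{1..r}"] that by (simp add: coupled_def)
    also have "\<dots> \<le> (\<Sum>i\<in>{1..r}. 1)"
      using that by (intro sum_mono) (simp add: coupled_def)
    finally show ?thesis by simp
  qed
  then have "{ys. \<exists>j. coupled j ys} \<subseteq> {ys. set ys \<subseteq> {1..r} \<and> length ys \<le> r}"
    by (auto simp: coupled_def)
  then show ?thesis
    by (rule finite_subset) (intro finite_lists_length_le, simp)
qed

lemma irreducible_coupled:
  obtains m ys where "s \<le> m * n" "coupled (m * n) ys" "\<Phi>_irreducible (ev x0 ys)"
proof -
  \<comment> \<open>The index \<open>s * n\<close> is late enough for the count rule and a multiple
    of the period.\<close>
  obtain ys0 where ys0: "coupled (s * n) ys0"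
    using coupled_exists by blast
  define v where "v k = (next_word ^^ k) ys0" for k
  have s: "s \<le> s * n" using n_pos by simp
  have v: "coupled (s * n + k) (v k)" for k
  proof (induction k)
    case (Suc k)
    then show ?case using coupled_next[OF trans_le_add1[OF s]] by (simp add: v_def)
  qed (simp add: v_def ys0)
  \<comment> \<open>Sampling only at multiples of \<open>n\<close> makes the recurring word coupled
    to an index at which the cycle is back at its start.\<close>
  have "range (\<lambda>a. v (a * n)) \<subseteq> {ys. \<exists>j. coupled j ys}"
    using v by blast
  then have "finite (range (\<lambda>a. v (a * n)))"
    using finite_coupled finite_subset by blast
  then have "\<not> inj (\<lambda>a. v (a * n))"
    using finite_imageD infinite_UNIV_nat by blast
  then obtain a b where ab: "a < b" "v (a * n) = v (b * n)"
    unfolding inj_on_def by (metis linorder_neqE_nat)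
  have "ev x0 (v (k + m)) \<in> nth_desc m (ev x0 (v k))" for k m
  proof (induction m)
    case (Suc m)
    have "ev x0 (v (k + Suc m)) \<in> first_desc (ev x0 (v (k + m)))"
      using next_word_desc[of "v (k + m)"] by (simp add: first_desc_ev v_def)
    with Suc show ?case by auto
  qed simp
  from this[of "a * n" "(b - a) * n"] have "ev x0 (v (a * n)) \<in> nth_desc ((b - a) * n) (ev x0 (v (a * n)))"
    using ab by (simp add: algebra_simps)
  moreover have "1 \<le> (b - a) * n"
    using ab(1) n_pos by (simp add: Suc_le_eq)
  ultimately have "ev x0 (v (a * n)) \<in> Desc (ev x0 (v (a * n)))"
    unfolding Desc_def by auto
  moreover have "finite (Desc (ev x0 (v (a * n))))"
    using v by (intro finite_Desc_ev) (auto simp: coupled_def)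
  ultimately have "\<Phi>_irreducible (ev x0 (v (a * n)))"
    by (simp add: \<Phi>_irreducible_def)
  moreover have "coupled ((s + a) * n) (v (a * n))"
    using v[of "a * n"] by (simp add: algebra_simps)
  moreover have "s \<le> (s + a) * n"
    using s by (simp add: algebra_simps trans_le_add1 trans_le_add2)
  ultimately show ?thesis using that by blast
qed

end

section \<open>Lifting a cycle of descendants to words\<close>

lemma nth_desc_chain:
  assumes "y \<in> nth_desc n w"
  shows "\<exists>f. f 0 = w \<and> f n = y \<and> (\<forall>j<n. f (Suc j) \<in> first_desc (f j))"
  using assms
proof (induction n arbitrary: y)
  case (Suc n)
  then obtain y' where "y' \<in> nth_desc n w" "y \<in> first_desc y'" by auto
  with Suc.IH obtain f where "f 0 = w" "f n = y'" "\<forall>j<n. f (Suc j) \<in> first_desc (f j)" by blast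
  with \<open>y \<in> first_desc y'\<close> show ?case
    by (intro exI[of _ "f(Suc n := y)"]) (auto simp: less_Suc_eq)
qed auto

theorem proposition5p32:
  fixes r s :: nat and x :: "nat \<Rightarrow> bit" and w :: "word \<Rightarrow> word"
  assumes "r > s" and "s > 0"
    and "w \<in> \<Gamma> r s x"
    and "\<Phi>_irreducible w"
  shows "\<exists>w'\<in>\<Gamma> r s (\<lambda>_. 0). \<Phi>_irreducible w' \<and>
           (\<exists>g\<in>carrier AutT. w = g \<otimes>\<^bsub>AutT\<^esub> w' \<otimes>\<^bsub>AutT\<^esub> inv\<^bsub>AutT\<^esub> g)"
proof -
  interpret preperiodic r s
    using assms by unfold_locales
  \<comment> \<open>The lift starts from a word for \<open>w\<close> with the fewest marks, which
    will force the number of marks to stay constant.\<close>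
  obtain xs0 where xs0: "set xs0 \<subseteq> {1..r}" "ev x xs0 = w"
    and min: "\<And>xs. set xs \<subseteq> {1..r} \<Longrightarrow> ev x xs = w \<Longrightarrow> mark_count xs0 \<le> mark_count xs"
    using \<Gamma>_ev[OF assms(3)] ex_has_least_nat[of "\<lambda>xs. set xs \<subseteq> {1..r} \<and> ev x xs = w" _ mark_count]
    by metis
  obtain n where n: "1 \<le> n" "w \<in> nth_desc n w"
    using assms(4) by (auto simp: \<Phi>_irreducible_def Desc_def)
  obtain f where f: "f 0 = w" "f n = w" "\<And>j. j < n \<Longrightarrow> f (Suc j) \<in> first_desc (f j)"
    using nth_desc_chain[OF n(2)] by blast
  define y where "y j = f (j mod n)" for j
  have y_mult: "y (k * n) = w" for k
    using f by (simp add: y_def)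
  have y_step: "y (Suc j) \<in> first_desc (y j)" for j
    using f(3)[of "j mod n"] n(1) f(1,2) by (cases "Suc (j mod n) = n") (simp_all add: y_def mod_Suc)
  have "\<exists>z. \<forall>j. (set (z j) \<subseteq> {1..r} \<and> ev x (z j) = y j \<and> (j = 0 \<longrightarrow> z j = xs0)) \<and> z (Suc j) \<in> desc_words x (z j)"
  proof (rule dependent_nat_choice)
    show "\<exists>xs. set xs \<subseteq> {1..r} \<and> ev x xs = y 0 \<and> (0 = 0 \<longrightarrow> xs = xs0)"
      using xs0 y_mult[of 0] by simp
  next
    fix xs j assume *: "set xs \<subseteq> {1..r} \<and> ev x xs = y j \<and> (j = 0 \<longrightarrow> xs = xs0)"
    then obtain ys where "ys \<in> desc_words x xs" "ev x ys = y (Suc j)"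
      using y_step[of j] first_desc_ev by (metis imageE)
    with * show "\<exists>ys. (set ys \<subseteq> {1..r} \<and> ev x ys = y (Suc j) \<and> (Suc j = 0 \<longrightarrow> ys = xs0)) \<and> ys \<in> desc_words x xs"
      using desc_words_letters by blast
  qed
  then obtain z where z: "\<And>j. set (z j) \<subseteq> {1..r}" "\<And>j. ev x (z j) = y j" "z 0 = xs0"
    "\<And>j. z (Suc j) \<in> desc_words x (z j)" by metis
  have anti: "mark_count (z j) \<le> mark_count (z i)" if "i \<le> j" for i j
    using lift_Suc_antimono_le[of "\<lambda>j. mark_count (z j)"] desc_words_mark_count[OF z(4,1)] that by blast
  have mark: "mark_count (z j) = mark_count xs0" for j
  proof (rule antisym)
    show "mark_count (z j) \<le> mark_count xs0" using anti[of 0 j] z(3) by simp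
    \<comment> \<open>At multiples of \<open>n\<close> the lift represents \<open>w\<close> again,
      so minimality applies; monotonicity covers the indices between.\<close>
    have "mark_count xs0 \<le> mark_count (z (j * n))"
      using min z(1) z(2) y_mult by simp
    also have "\<dots> \<le> mark_count (z j)" using n(1) by (intro anti) simp
    finally show "mark_count xs0 \<le> mark_count (z j)" .
  qed
  interpret periodic_words r s x z n
  proof
    \<comment> \<open>The words may differ after a period, but this parity depends only on the
      automorphism they represent.\<close>
    show "odd (count_list (z (j + n)) 1) = odd (count_list (z j) 1)" for j
      using ev_eq_even_iff[of x "z (j + n)" x "z j"] z(2) by (simp add: y_def)
  qed (use z mark n in auto)
  obtain m ys where ys: "s \<le> m * n" "coupled (m * n) ys" "\<Phi>_irreducible (ev x0 ys)"
    using irreducible_coupled .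
  obtain g where g: "g \<in> tree_auts" "g \<circ> ev x0 ys = ev x (z (m * n)) \<circ> g"
    using coupled_conjugate[OF ys(1,2)] .
  then have "w \<otimes>\<^bsub>AutT\<^esub> g = g \<otimes>\<^bsub>AutT\<^esub> ev x0 ys"
    using z(2) y_mult by simp
  then have "w = g \<otimes>\<^bsub>AutT\<^esub> ev x0 ys \<otimes>\<^bsub>AutT\<^esub> inv\<^bsub>AutT\<^esub> g"
    using group.inv_solve_right[OF group_AutT, of w "g \<otimes>\<^bsub>AutT\<^esub> ev x0 ys" g] g(1) xs0(2)
    by (metis carrier_AutT comp_tree_auts ev_tree_auts mult_AutT)
  moreover have "ev x0 ys \<in> \<Gamma> r s x0"
    using ys(2) by (intro ev_in_\<Gamma>) (simp add: coupled_def)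
  ultimately show ?thesis
    using ys(3) g(1) by auto
qed

end
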